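(* Let $a>0$, $i_1,i_3>0$, $\mu_r>0$, and consider the system for $(\boldsymbol\omega,\boldsymbol\gamma)\in\mathbb R^3\times\mathbb R^3$ $$\mathbf J\dot{\boldsymbol\omega}+\boldsymbol\omega\times\mathbf I\boldsymbol\omega+\big((\boldsymbol\omega,\tfrac{d}{dt}(\boldsymbol r\times\boldsymbol\gamma))-1\big)\,\boldsymbol r\times\boldsymbol\gamma=-\mu_r\,\boldsymbol\gamma\times(\boldsymbol\omega\times\boldsymbol\gamma),\qquad \dot{\boldsymbol\gamma}+\boldsymbol\omega\times\boldsymbol\gamma=0 .$$ For $C\in\mathbb R$ let $\sigma_l$ be the fixed point $\boldsymbol\gamma=(0,0,-1)$, $\boldsymbol\omega=(0,0,-C/i_3)$ (lower vertical rotation) and $\sigma_u$ the fixed point $\boldsymbol\gamma=(0,0,1)$, $\boldsymbol\omega=(0,0,C/i_3)$ (upper vertical rotation), both lying on the level set $(\mathbf J\boldsymbol\omega,\boldsymbol\gamma)=C$ of the area integral. Then there are no values of $a>0$, $i_1>0$, $i_3>0$, $\mu_r>0$ and of $C\in\mathbb R$ for which $\sigma_l$ is linearly unstable and $\sigma_u$ is linearly stable (so that, in this sense, a complete tippe top inversion from the lower to the upper vertical rotation is impossible).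
   Context: The system describes, in dimensionless variables (mass, radius and gravitational acceleration equal to $1$), the rolling with slipping of an axisymmetric unbalanced ball (tippe top) on a plane when the only dissipative action is the horizontal rolling resistance torque $-\mu_r\boldsymbol\omega_\bot$, $\boldsymbol\omega_\bot=\boldsymbol\omega-(\boldsymbol\omega,\boldsymbol\gamma)\boldsymbol\gamma$. Notation: $\mathbf I=\mathrm{diag}(i_1,i_1,i_3)$, $\boldsymbol a=(0,0,a)$, $\boldsymbol r=-\boldsymbol\gamma-\boldsymbol a$, $\mathbf J=\mathbf I+(\boldsymbol r\times\boldsymbol\gamma)\otimes(\boldsymbol r\times\boldsymbol\gamma)$ with $(\boldsymbol x\otimes\boldsymbol y)_{ij}=x_iy_j$; thus $\boldsymbol r\times\boldsymbol\gamma=(a\gamma_2,-a\gamma_1,0)$ and $\frac{d}{dt}(\boldsymbol r\times\boldsymbol\gamma)=-\boldsymbol a\times(\boldsymbol\gamma\times\boldsymbol\omega)$. The characteristic polynomial of the linearization of the six-dimensional system at each of these fixed points has the form $\lambda^2P_4(\lambda)$, the two zero eigenvalues corresponding to the integrals $(\boldsymbol\gamma,\boldsymbol\gamma)$ and $(\mathbf J\boldsymbol\omega,\boldsymbol\gamma)$; the fixed point is called linearly stable if all four roots of $P_4$ have negative real parts, and linearly unstable if at least one root of $P_4$ has positive real part. *)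

theory Defs
  imports "HOL-Analysis.Analysis" "Jordan_Normal_Form.Char_Poly"
begin

no_notation Matrix.vec_index (infixl "$" 100)
unbundle cross3_syntax

type_synonym state = "(real^3) \<times> (real^3)"

definition inertia :: "real \<Rightarrow> real \<Rightarrow> real^3^3" where
  "inertia i1 i3 = vector [vector [i1, 0, 0], vector [0, i1, 0], vector [0, 0, i3]]"

definition avec :: "real \<Rightarrow> real^3" where
  "avec a = vector [0, 0, a]"

definition rvec :: "real \<Rightarrow> real^3 \<Rightarrow> real^3" where
  "rvec a \<gamma> = - \<gamma> - avec a"

definition outer :: "real^3 \<Rightarrow> real^3 \<Rightarrow> real^3^3" where
  "outer x y = (\<chi> i j. x $ i * y $ j)"

definition Jmat :: "real \<Rightarrow> real \<Rightarrow> real \<Rightarrow> real^3 \<Rightarrow> real^3^3" where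
  "Jmat a i1 i3 \<gamma> = inertia i1 i3 + outer (rvec a \<gamma> \<times> \<gamma>) (rvec a \<gamma> \<times> \<gamma>)"

(* Time derivative of r x gamma along gamma' = gamma x omega; see r_cross_gamma_derivative. *)
definition rg_deriv :: "real \<Rightarrow> real^3 \<Rightarrow> real^3 \<Rightarrow> real^3" where
  "rg_deriv a \<omega> \<gamma> = - (avec a \<times> (\<gamma> \<times> \<omega>))"

definition tippe_top_system ::
  "real \<Rightarrow> real \<Rightarrow> real \<Rightarrow> real \<Rightarrow> state \<Rightarrow> state \<Rightarrow> bool" where
  "tippe_top_system a i1 i3 \<mu> = (\<lambda>(\<omega>, \<gamma>) (\<omega>', \<gamma>').
     Jmat a i1 i3 \<gamma> *v \<omega>' + \<omega> \<times> (inertia i1 i3 *v \<omega>)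
         + (inner \<omega> (rg_deriv a \<omega> \<gamma>) - 1) *\<^sub>R (rvec a \<gamma> \<times> \<gamma>)
       = - (\<mu> *\<^sub>R (\<gamma> \<times> (\<omega> \<times> \<gamma>))) \<and>
     \<gamma>' + \<omega> \<times> \<gamma> = 0)"

(* The system solved for the derivatives; see tippe_top_system_iff_field. *)
definition tippe_top_field ::
  "real \<Rightarrow> real \<Rightarrow> real \<Rightarrow> real \<Rightarrow> state \<Rightarrow> state" where
  "tippe_top_field a i1 i3 \<mu> = (\<lambda>(\<omega>, \<gamma>).
     (matrix_inv (Jmat a i1 i3 \<gamma>) *v
        (- (\<mu> *\<^sub>R (\<gamma> \<times> (\<omega> \<times> \<gamma>))) - \<omega> \<times> (inertia i1 i3 *v \<omega>)
           - (inner \<omega> (rg_deriv a \<omega> \<gamma>) - 1) *\<^sub>R (rvec a \<gamma> \<times> \<gamma>)),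
      - (\<omega> \<times> \<gamma>)))"

definition fixed_point :: "real \<Rightarrow> real \<Rightarrow> real \<Rightarrow> real \<Rightarrow> state \<Rightarrow> bool" where
  "fixed_point a i1 i3 \<mu> p \<longleftrightarrow> tippe_top_system a i1 i3 \<mu> p (0, 0)"

definition area_integral :: "real \<Rightarrow> real \<Rightarrow> real \<Rightarrow> state \<Rightarrow> real" where
  "area_integral a i1 i3 = (\<lambda>(\<omega>, \<gamma>). inner (Jmat a i1 i3 \<gamma> *v \<omega>) \<gamma>)"

definition sigma_l :: "real \<Rightarrow> real \<Rightarrow> state" where
  "sigma_l i3 C = (vector [0, 0, - C / i3], vector [0, 0, -1])"

definition sigma_u :: "real \<Rightarrow> real \<Rightarrow> state" where
  "sigma_u i3 C = (vector [0, 0, C / i3], vector [0, 0, 1])"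

definition state_basis :: "state list" where
  "state_basis = [(axis 1 1, 0), (axis 2 1, 0), (axis 3 1, 0),
                  (0, axis 1 1), (0, axis 2 1), (0, axis 3 1)]"

definition linearization ::
  "real \<Rightarrow> real \<Rightarrow> real \<Rightarrow> real \<Rightarrow> state \<Rightarrow> real Matrix.mat" where
  "linearization a i1 i3 \<mu> p = Matrix.mat 6 6 (\<lambda>(i, j).
     inner (state_basis ! i)
       (frechet_derivative (tippe_top_field a i1 i3 \<mu>) (at p) (state_basis ! j)))"

(* The division by lambda^2 is exact at sigma_l and sigma_u; see char_poly_sigma. *)
definition P4 :: "real \<Rightarrow> real \<Rightarrow> real \<Rightarrow> real \<Rightarrow> state \<Rightarrow> real poly" where
  "P4 a i1 i3 \<mu> p = char_poly (linearization a i1 i3 \<mu> p) div monom 1 2"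

definition linearly_stable :: "real \<Rightarrow> real \<Rightarrow> real \<Rightarrow> real \<Rightarrow> state \<Rightarrow> bool" where
  "linearly_stable a i1 i3 \<mu> p \<longleftrightarrow>
     (\<forall>z::complex. poly (map_poly of_real (P4 a i1 i3 \<mu> p)) z = 0 \<longrightarrow> Re z < 0)"

definition linearly_unstable :: "real \<Rightarrow> real \<Rightarrow> real \<Rightarrow> real \<Rightarrow> state \<Rightarrow> bool" where
  "linearly_unstable a i1 i3 \<mu> p \<longleftrightarrow>
     (\<exists>z::complex. poly (map_poly of_real (P4 a i1 i3 \<mu> p)) z = 0 \<and> Re z > 0)"

lemma r_cross_gamma_derivative:
  assumes "(\<gamma> has_vector_derivative \<gamma> t \<times> \<omega>) (at t)"
  shows "((\<lambda>s. rvec a (\<gamma> s) \<times> \<gamma> s) has_vector_derivative rg_deriv a \<omega> (\<gamma> t)) (at t)"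
proof -
  have eq: "(\<lambda>s. rvec a (\<gamma> s) \<times> \<gamma> s) = (\<lambda>s. - (avec a \<times> \<gamma> s))"
    by (auto simp: rvec_def cross_minus_left left_diff_distrib cross3_simps)
  have "bounded_linear (\<lambda>x. avec a \<times> x)"
    using bilinear_cross by (simp add: bilinear_def linear_conv_bounded_linear)
  from bounded_linear.has_vector_derivative[OF this assms]
  show ?thesis unfolding eq rg_deriv_def by (intro has_vector_derivative_minus)
qed

lemma inertia_nth:
  "inertia i1 i3 $ i $ j = (if i = j then if i = 3 then i3 else i1 else 0)"
  using exhaust_3[of i] exhaust_3[of j] by (auto simp: inertia_def)

lemma r_cross_gamma: "rvec a \<gamma> \<times> \<gamma> = vector [a * \<gamma> $ 2, - (a * \<gamma> $ 1), 0]"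
  by (simp add: Finite_Cartesian_Product.vec_eq_iff forall_3 rvec_def avec_def cross3_def algebra_simps)

lemma det_Jmat:
  "Determinants.det (Jmat a i1 i3 \<gamma>) = i3 * (i1\<^sup>2 + i1 * a\<^sup>2 * ((\<gamma> $ 1)\<^sup>2 + (\<gamma> $ 2)\<^sup>2))"
  by (simp add: det_3 Jmat_def inertia_nth outer_def r_cross_gamma algebra_simps power2_eq_square)

lemma invertible_Jmat:
  assumes "i1 > 0" "i3 > 0"
  shows "invertible (Jmat a i1 i3 \<gamma>)"
proof -
  have "i1\<^sup>2 + i1 * a\<^sup>2 * ((\<gamma> $ 1)\<^sup>2 + (\<gamma> $ 2)\<^sup>2) > 0"
    using assms by (intro add_pos_nonneg) auto
  then show ?thesis using assms by (simp add: invertible_det_nz det_Jmat)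
qed

lemma Jmat_solve:
  assumes "i1 > 0" "i3 > 0"
  shows "Jmat a i1 i3 \<gamma> *v x = y \<longleftrightarrow> x = matrix_inv (Jmat a i1 i3 \<gamma>) *v y"
proof -
  have "Jmat a i1 i3 \<gamma> ** matrix_inv (Jmat a i1 i3 \<gamma>) = Finite_Cartesian_Product.mat 1"
    "matrix_inv (Jmat a i1 i3 \<gamma>) ** Jmat a i1 i3 \<gamma> = Finite_Cartesian_Product.mat 1"
    using someI_ex[OF invertible_Jmat[OF assms, unfolded invertible_def]]
    by (auto simp: matrix_inv_def)
  then show ?thesis by (metis matrix_vector_mul_assoc matrix_vector_mul_lid)
qed

lemma tippe_top_system_iff_field:
  assumes "i1 > 0" "i3 > 0"
  shows "tippe_top_system a i1 i3 \<mu> p p' \<longleftrightarrow> p' = tippe_top_field a i1 i3 \<mu> p"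
proof -
  obtain \<omega> \<gamma> \<omega>' \<gamma>' where p: "p = (\<omega>, \<gamma>)" "p' = (\<omega>', \<gamma>')" by (metis surj_pair)
  have *: "u + v + w = z \<longleftrightarrow> u = z - v - w" for u v w z :: "real^3"
    by (auto simp: algebra_simps)
  show ?thesis unfolding p tippe_top_system_def tippe_top_field_def prod.case
    by (simp only: * Jmat_solve[OF assms] add_eq_0_iff2 prod.inject)
qed

lemma vector_0_3: "vector [0, 0, 0] = (0 :: real^3)"
  by (simp add: Finite_Cartesian_Product.vec_eq_iff forall_3)

lemma fixed_point_sigma:
  "fixed_point a i1 i3 \<mu> (sigma_l i3 C)" "fixed_point a i1 i3 \<mu> (sigma_u i3 C)"
  unfolding fixed_point_def tippe_top_system_def sigma_l_def sigma_u_def r_cross_gamma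
  by (simp_all add: vector_0_3, simp_all add: cross3_def Finite_Cartesian_Product.vec_eq_iff forall_3 matrix_vector_mult_def sum_3 inertia_nth)

lemma area_integral_sigma:
  assumes "i3 \<noteq> 0"
  shows "area_integral a i1 i3 (sigma_l i3 C) = C" "area_integral a i1 i3 (sigma_u i3 C) = C"
  using assms
  by (simp_all add: area_integral_def sigma_l_def sigma_u_def Jmat_def r_cross_gamma outer_def
      inner_vec_def matrix_vector_mult_def sum_3 inertia_nth)


definition force :: "real \<Rightarrow> real \<Rightarrow> real \<Rightarrow> real \<Rightarrow> state \<Rightarrow> real^3" where
  "force a i1 i3 \<mu> = (\<lambda>(\<omega>, \<gamma>). - (\<mu> *\<^sub>R (\<gamma> \<times> (\<omega> \<times> \<gamma>))) - \<omega> \<times> (inertia i1 i3 *v \<omega>)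
           - (inner \<omega> (rg_deriv a \<omega> \<gamma>) - 1) *\<^sub>R (rvec a \<gamma> \<times> \<gamma>))"

lemma field_components:
  fixes p :: state and a i1 i3 \<mu> :: real
  assumes i: "i1 > 0" "i3 > 0"
  defines "F \<equiv> tippe_top_field a i1 i3 \<mu> p" and "g \<equiv> force a i1 i3 \<mu> p"
    and "D \<equiv> i1\<^sup>2 + i1 * a\<^sup>2 * ((snd p $ 1)\<^sup>2 + (snd p $ 2)\<^sup>2)"
  shows "fst F $ 1 = ((i1 + a\<^sup>2 * (snd p $ 1)\<^sup>2) * g $ 1 + a\<^sup>2 * snd p $ 1 * snd p $ 2 * g $ 2) / D"
    "fst F $ 2 = ((i1 + a\<^sup>2 * (snd p $ 2)\<^sup>2) * g $ 2 + a\<^sup>2 * snd p $ 1 * snd p $ 2 * g $ 1) / D"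
    "fst F $ 3 = g $ 3 / i3"
    "snd F = - (fst p \<times> snd p)"
proof -
  obtain \<omega> \<gamma> where p: "p = (\<omega>, \<gamma>)" by (metis surj_pair)
  have D: "D > 0" unfolding D_def using i by (intro add_pos_nonneg) auto
  define X where "X = ((i1 + a\<^sup>2 * (\<gamma> $ 1)\<^sup>2) * g $ 1 + a\<^sup>2 * \<gamma> $ 1 * \<gamma> $ 2 * g $ 2) / D"
  define Y where "Y = ((i1 + a\<^sup>2 * (\<gamma> $ 2)\<^sup>2) * g $ 2 + a\<^sup>2 * \<gamma> $ 1 * \<gamma> $ 2 * g $ 1) / D"
  define x :: "real^3" where "x = vector [X, Y, g $ 3 / i3]"
  have XD: "X * D = (i1 + a\<^sup>2 * (\<gamma> $ 1)\<^sup>2) * g $ 1 + a\<^sup>2 * \<gamma> $ 1 * \<gamma> $ 2 * g $ 2"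
    and YD: "Y * D = (i1 + a\<^sup>2 * (\<gamma> $ 2)\<^sup>2) * g $ 2 + a\<^sup>2 * \<gamma> $ 1 * \<gamma> $ 2 * g $ 1"
    using D by (simp_all add: X_def Y_def)
  have "((i1 + a\<^sup>2 * (\<gamma> $ 2)\<^sup>2) * X - a\<^sup>2 * \<gamma> $ 1 * \<gamma> $ 2 * Y) * D
      = (i1 + a\<^sup>2 * (\<gamma> $ 2)\<^sup>2) * (X * D) - a\<^sup>2 * \<gamma> $ 1 * \<gamma> $ 2 * (Y * D)"
    by (simp add: algebra_simps)
  also have "\<dots> = g $ 1 * D"
    unfolding XD YD by (simp add: D_def p algebra_simps power2_eq_square)
  finally have "(i1 + a\<^sup>2 * (\<gamma> $ 2)\<^sup>2) * X - a\<^sup>2 * \<gamma> $ 1 * \<gamma> $ 2 * Y = g $ 1"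
    using D by simp
  then have "(Jmat a i1 i3 \<gamma> *v x) $ 1 = g $ 1"
    unfolding x_def
    by (simp add: matrix_vector_mult_def sum_3 Jmat_def inertia_nth outer_def r_cross_gamma
        power2_eq_square algebra_simps)
  moreover have "((i1 + a\<^sup>2 * (\<gamma> $ 1)\<^sup>2) * Y - a\<^sup>2 * \<gamma> $ 1 * \<gamma> $ 2 * X) * D
      = (i1 + a\<^sup>2 * (\<gamma> $ 1)\<^sup>2) * (Y * D) - a\<^sup>2 * \<gamma> $ 1 * \<gamma> $ 2 * (X * D)"
    by (simp add: algebra_simps)
  moreover have "\<dots> = g $ 2 * D"
    unfolding XD YD by (simp add: D_def p algebra_simps power2_eq_square)
  ultimately have "(Jmat a i1 i3 \<gamma> *v x) $ 1 = g $ 1"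
    and "(i1 + a\<^sup>2 * (\<gamma> $ 1)\<^sup>2) * Y - a\<^sup>2 * \<gamma> $ 1 * \<gamma> $ 2 * X = g $ 2"
    using D by simp_all
  moreover from this(2) have "(Jmat a i1 i3 \<gamma> *v x) $ 2 = g $ 2"
    unfolding x_def
    by (simp add: matrix_vector_mult_def sum_3 Jmat_def inertia_nth outer_def r_cross_gamma
        power2_eq_square algebra_simps)
  moreover have "(Jmat a i1 i3 \<gamma> *v x) $ 3 = g $ 3"
    unfolding x_def using i
    by (simp add: matrix_vector_mult_def sum_3 Jmat_def inertia_nth outer_def r_cross_gamma)
  ultimately have "Jmat a i1 i3 \<gamma> *v x = g"
    using D by (simp add: Finite_Cartesian_Product.vec_eq_iff forall_3)
  then have "x = fst F"
    using i by (simp add: Jmat_solve F_def g_def p tippe_top_field_def force_def)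
  from this[symmetric] show "fst F $ 1 = ((i1 + a\<^sup>2 * (snd p $ 1)\<^sup>2) * g $ 1 + a\<^sup>2 * snd p $ 1 * snd p $ 2 * g $ 2) / D"
    "fst F $ 2 = ((i1 + a\<^sup>2 * (snd p $ 2)\<^sup>2) * g $ 2 + a\<^sup>2 * snd p $ 1 * snd p $ 2 * g $ 1) / D"
    "fst F $ 3 = g $ 3 / i3"
    by (simp_all add: x_def X_def Y_def p)
  show "snd F = - (fst p \<times> snd p)" by (simp add: F_def p tippe_top_field_def)
qed

lemma force_components:
  "force a i1 i3 \<mu> p $ 1 = - \<mu> * ((snd p $ 2) * (fst p $ 1 * snd p $ 2 - fst p $ 2 * snd p $ 1)
      - snd p $ 3 * (fst p $ 3 * snd p $ 1 - fst p $ 1 * snd p $ 3))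
    - (i3 - i1) * fst p $ 2 * fst p $ 3
    - (inner (fst p) (rg_deriv a (fst p) (snd p)) - 1) * (a * snd p $ 2)"
  "force a i1 i3 \<mu> p $ 2 = - \<mu> * ((snd p $ 3) * (fst p $ 2 * snd p $ 3 - fst p $ 3 * snd p $ 2)
      - snd p $ 1 * (fst p $ 1 * snd p $ 2 - fst p $ 2 * snd p $ 1))
    - (i1 - i3) * fst p $ 1 * fst p $ 3
    + (inner (fst p) (rg_deriv a (fst p) (snd p)) - 1) * (a * snd p $ 1)"
  "force a i1 i3 \<mu> p $ 3 = - \<mu> * (snd p $ 1 * (fst p $ 3 * snd p $ 1 - fst p $ 1 * snd p $ 3)
      - snd p $ 2 * (fst p $ 2 * snd p $ 3 - fst p $ 3 * snd p $ 2))"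
  by (cases p; simp only: force_def r_cross_gamma prod.case fst_conv snd_conv,
      simp add: cross3_def matrix_vector_mult_def sum_3 inertia_nth algebra_simps)+

lemma rg_deriv_inner:
  "inner \<omega> (rg_deriv a \<omega> \<gamma>) = a * (\<omega> $ 1 * (\<gamma> $ 3 * \<omega> $ 1 - \<gamma> $ 1 * \<omega> $ 3)
     - \<omega> $ 2 * (\<gamma> $ 2 * \<omega> $ 3 - \<gamma> $ 3 * \<omega> $ 2))"
  by (simp add: rg_deriv_def avec_def cross3_def inner_vec_def sum_3 algebra_simps)

lemma differentiable_coord [simp]:
  "(\<lambda>p::state. fst p $ i) differentiable at q" "(\<lambda>p::state. snd p $ i) differentiable at q"
proof -
  have "bounded_linear (\<lambda>p::state. fst p $ i)" "bounded_linear (\<lambda>p::state. snd p $ i)"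
    by (intro bounded_linear_compose[OF bounded_linear_vec_nth] bounded_linear_fst bounded_linear_snd)+
  then show "(\<lambda>p::state. fst p $ i) differentiable at q"
    "(\<lambda>p::state. snd p $ i) differentiable at q"
    by (auto intro: bounded_linear_imp_differentiable)
qed

lemma state_decomp:
  "(p::state) = fst p $ 1 *\<^sub>R (axis 1 1, 0) + fst p $ 2 *\<^sub>R (axis 2 1, 0) + fst p $ 3 *\<^sub>R (axis 3 1, 0)
     + snd p $ 1 *\<^sub>R (0, axis 1 1) + snd p $ 2 *\<^sub>R (0, axis 2 1) + snd p $ 3 *\<^sub>R (0, axis 3 1)"
  by (simp add: prod_eq_iff) (simp add: Finite_Cartesian_Product.vec_eq_iff forall_3 axis_def)

lemma tippe_top_field_differentiable:
  assumes i: "i1 > 0" "i3 > 0"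
  shows "tippe_top_field a i1 i3 \<mu> differentiable at q"
proof -
  let ?F = "tippe_top_field a i1 i3 \<mu>"
  have f: "(\<lambda>p. force a i1 i3 \<mu> p $ 1) differentiable at q"
    "(\<lambda>p. force a i1 i3 \<mu> p $ 2) differentiable at q"
    "(\<lambda>p. force a i1 i3 \<mu> p $ 3) differentiable at q"
    unfolding force_components rg_deriv_inner
    by (intro differentiable_add differentiable_diff differentiable_mult differentiable_const
        differentiable_minus differentiable_coord)+
  have D: "i1\<^sup>2 + i1 * a\<^sup>2 * ((snd q $ 1)\<^sup>2 + (snd q $ 2)\<^sup>2) \<noteq> 0"
    using i by (intro less_imp_neq[symmetric] add_pos_nonneg) auto
  have "(\<lambda>p. fst (?F p) $ 1) differentiable at q" "(\<lambda>p. fst (?F p) $ 2) differentiable at q"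
    "(\<lambda>p. fst (?F p) $ 3) differentiable at q"
    unfolding field_components[OF i] using D i
    by (intro differentiable_add differentiable_mult differentiable_const differentiable_power
        differentiable_divide differentiable_coord f; simp)+
  moreover have "(\<lambda>p. snd (?F p) $ 1) differentiable at q" "(\<lambda>p. snd (?F p) $ 2) differentiable at q"
    "(\<lambda>p. snd (?F p) $ 3) differentiable at q"
    unfolding field_components[OF i] by (simp_all add: cross3_def)
  ultimately show ?thesis
    by (subst state_decomp[of "?F _", abs_def])
       (intro differentiable_add differentiable_scaleR differentiable_const)
qed


lemma linearization_row_eq_0:
  assumes i: "i1 > 0" "i3 > 0" and k: "k < 6" and j: "j < 6"
    and der: "((\<lambda>p. inner (state_basis ! k) (tippe_top_field a i1 i3 \<mu> p)) has_derivative (\<lambda>_. 0)) (at q)"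
  shows "linearization a i1 i3 \<mu> q $$ (k, j) = 0"
proof -
  let ?F = "tippe_top_field a i1 i3 \<mu>"
  have "(?F has_derivative frechet_derivative ?F (at q)) (at q)"
    using tippe_top_field_differentiable[OF i] by (simp add: frechet_derivative_works)
  then have "((\<lambda>p. inner (state_basis ! k) (?F p)) has_derivative
      (\<lambda>v. inner (state_basis ! k) (frechet_derivative ?F (at q) v))) (at q)"
    by (rule has_derivative_inner_right)
  from fun_cong[OF has_derivative_unique[OF this der], of "state_basis ! j"] show ?thesis
    using k j by (simp add: linearization_def)
qed

lemma has_derivative_coord:
  "((\<lambda>p::state. fst p $ i) has_derivative (\<lambda>v. fst v $ i)) (at q)"
  "((\<lambda>p::state. snd p $ i) has_derivative (\<lambda>v. snd v $ i)) (at q)"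
  by (intro bounded_linear_imp_has_derivative bounded_linear_compose[OF bounded_linear_vec_nth]
      bounded_linear_fst bounded_linear_snd)+

lemma linearization_vertical_rows:
  assumes i: "i1 > 0" "i3 > 0" and j: "j < 6"
    and q: "fst q $ 1 = 0" "fst q $ 2 = 0" "snd q $ 1 = 0" "snd q $ 2 = 0"
  shows "linearization a i1 i3 \<mu> q $$ (2, j) = 0" "linearization a i1 i3 \<mu> q $$ (5, j) = 0"
proof -
  let ?F = "tippe_top_field a i1 i3 \<mu>"
  have "inner (state_basis ! 2) (?F p) = fst (?F p) $ 3"
    "inner (state_basis ! 5) (?F p) = snd (?F p) $ 3" for p
    by (simp_all add: state_basis_def inner_prod_def inner_axis' del: One_nat_def)
  moreover have "((\<lambda>p. fst (?F p) $ 3) has_derivative (\<lambda>_. 0)) (at q)"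
    unfolding field_components[OF i] force_components using q
    by (auto intro!: derivative_eq_intros has_derivative_coord simp: i less_imp_neq[symmetric])
  moreover have "((\<lambda>p. snd (?F p) $ 3) has_derivative (\<lambda>_. 0)) (at q)"
    unfolding field_components[OF i] using q
    by (auto simp: cross3_def intro!: derivative_eq_intros has_derivative_coord)
  ultimately show "linearization a i1 i3 \<mu> q $$ (2, j) = 0" "linearization a i1 i3 \<mu> q $$ (5, j) = 0"
    by (simp_all add: linearization_row_eq_0[OF i _ j])
qed

lemma char_poly_zero_row:
  fixes A :: "real Matrix.mat"
  assumes A: "A \<in> carrier_mat n n" and k: "k < n" and 0: "\<And>j. j < n \<Longrightarrow> A $$ (k, j) = 0"
  shows "char_poly A = [:0, 1:] * char_poly (mat_delete A k k)"
proof -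
  let ?C = "char_poly_matrix A"
  have C: "?C \<in> carrier_mat n n" using A by simp
  have "?C $$ (k, j) = (if j = k then [:0, 1:] else 0)" if "j < n" for j
    using that A k 0[OF that] by (auto simp: char_poly_matrix_def)
  then have "Determinant.det ?C = (\<Sum>j<n. if j = k then [:0, 1:] * cofactor ?C k j else 0)"
    unfolding laplace_expansion_row[OF C k] by (intro sum.cong) auto
  also have "\<dots> = [:0, 1:] * cofactor ?C k k" using k by simp
  also have "cofactor ?C k k = Determinant.det (mat_delete ?C k k)" by (simp add: cofactor_def)
  also have "mat_delete ?C k k = char_poly_matrix (mat_delete A k k)"
    using A k by (intro eq_matI) (auto simp: mat_delete_def char_poly_matrix_def)
  finally show ?thesis by (simp add: char_poly_def)
qed

lemma char_poly_vertical:
  assumes i: "i1 > 0" "i3 > 0"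
    and q: "fst q $ 1 = 0" "fst q $ 2 = 0" "snd q $ 1 = 0" "snd q $ 2 = 0"
  shows "char_poly (linearization a i1 i3 \<mu> q) = monom 1 2 * P4 a i1 i3 \<mu> q"
    and "degree (P4 a i1 i3 \<mu> q) = 4"
proof -
  let ?A = "linearization a i1 i3 \<mu> q"
  let ?B = "mat_delete ?A 5 5"
  have A: "?A \<in> carrier_mat 6 6" by (simp add: linearization_def)
  have B: "?B \<in> carrier_mat 5 5" using mat_delete_carrier[OF A] by simp
  have "?B $$ (2, j) = 0" if "j < 5" for j
    using linearization_vertical_rows(1)[OF i _ q, of j] A that by (simp add: mat_delete_def)
  from char_poly_zero_row[OF B _ this]
  have "char_poly ?B = [:0, 1:] * char_poly (mat_delete ?B 2 2)" by simp
  moreover have "char_poly ?A = [:0, 1:] * char_poly ?B"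
    using linearization_vertical_rows(2)[OF i _ q] by (intro char_poly_zero_row[OF A]) auto
  moreover have "monom 1 2 = [:0, 1:] * [:0, 1:: real:]"
    by (simp add: monom_altdef power2_eq_square)
  ultimately have *: "char_poly ?A = monom 1 2 * char_poly (mat_delete ?B 2 2)"
    by (simp only: mult.assoc)
  then show eq: "char_poly ?A = monom 1 2 * P4 a i1 i3 \<mu> q"
    by (simp add: P4_def)
  have "degree (char_poly ?A) = 6" using degree_monic_char_poly[OF A] by simp
  moreover from this have "P4 a i1 i3 \<mu> q \<noteq> 0" using eq by auto
  ultimately show "degree (P4 a i1 i3 \<mu> q) = 4"
    unfolding eq by (simp add: degree_mult_eq degree_monom_eq)
qed

lemma char_poly_sigma:
  assumes "i1 > 0" "i3 > 0" and "p = sigma_l i3 C \<or> p = sigma_u i3 C"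
  shows "char_poly (linearization a i1 i3 \<mu> p) = monom 1 2 * P4 a i1 i3 \<mu> p"
    and "degree (P4 a i1 i3 \<mu> p) = 4"
  using assms by (auto simp: sigma_l_def sigma_u_def intro!: char_poly_vertical)

end

theory Submission
  imports Defs
begin

text \<open>
  At a vertical rotation \<open>\<gamma> = (0, 0, s)\<close>, \<open>\<omega> = (0, 0, w)\<close> with \<open>s = 1\<close> or \<open>s = - 1\<close>, the linearized
  system commutes with the rotations about the vertical axis. In the complex variables
  \<open>u = \<omega>\<^sub>1 + \<i> \<omega>\<^sub>2\<close> and \<open>h = \<gamma>\<^sub>1 + \<i> \<gamma>\<^sub>2\<close> its horizontal part is therefore a \<open>2\<times>2\<close> system over the
  complex numbers,
  \<open>i\<^sub>1 u' = (- \<mu> + \<i> (i\<^sub>3 - i\<^sub>1) w) u + (\<mu> s w - \<i> a) h\<close> and \<open>h' = \<i> s u - \<i> w h\<close>,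
  and the nonzero roots of \<open>P\<^sub>4\<close> are those of its characteristic polynomial
  \<open>i\<^sub>1 z\<^sup>2 + (\<mu> - \<i> w (i\<^sub>3 - 2 i\<^sub>1)) z + (i\<^sub>3 - i\<^sub>1) w\<^sup>2 - s a\<close>
  and of the conjugate polynomial (lemma \<open>P4_root_iff\<close>). The rolling resistance cancels from the constant
  term, which is thus a real number \<open>d\<close>.

  Such a quadratic is decided by the sign of \<open>d\<close>. After division by \<open>z\<close> the real part of the
  equation shows that \<open>d \<ge> 0\<close> excludes roots in the open right half-plane
  (\<open>friction_quadratic_no_right_root\<close>). If \<open>d < 0\<close>, the two roots have a negative real product, so
  their real parts have opposite signs (\<open>friction_quadratic_right_root\<close>).

  Both rotations have the same \<open>w\<^sup>2 = (C / i\<^sub>3)\<^sup>2\<close>, so \<open>d\<close> equals \<open>(i\<^sub>3 - i\<^sub>1) w\<^sup>2 + a\<close> at the lower and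
  \<open>(i\<^sub>3 - i\<^sub>1) w\<^sup>2 - a\<close> at the upper one. If the lower rotation is unstable, the former is negative,
  then so is the latter, and the upper rotation is unstable as well.
\<close>

section \<open>Quadratics with a dissipative middle term and a real constant term\<close>

text \<open>
  Multiplied by the conjugate of \<open>z\<close>, the equation has the real part
  \<open>(k Re z + Re c) |z|\<^sup>2 + d Re z = 0\<close>; the imaginary part of \<open>c\<close> has dropped out.
\<close>

lemma friction_quadratic_no_right_root:
  fixes z c :: complex and k d :: real
  assumes "k > 0" "Re c > 0" "d \<ge> 0"
    and root: "of_real k * z\<^sup>2 + c * z + of_real d = 0"
  shows "Re z \<le> 0"
proof (rule ccontr)
  assume "\<not> Re z \<le> 0"
  then have z: "Re z > 0" by simp
  have "Re (cnj z * (of_real k * z\<^sup>2 + c * z + of_real d)) = 0"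
    by (simp only: root mult_zero_right zero_complex.sel)
  moreover have "Re (cnj z * (of_real k * z\<^sup>2 + c * z + of_real d))
      = (k * Re z + Re c) * ((Re z)\<^sup>2 + (Im z)\<^sup>2) + d * Re z"
    by (simp add: power2_eq_square algebra_simps)
  moreover have "(k * Re z + Re c) * ((Re z)\<^sup>2 + (Im z)\<^sup>2) + d * Re z > 0"
    using assms(1-3) z by (intro add_pos_nonneg mult_pos_pos add_pos_pos) auto
  ultimately show False by simp
qed

text \<open>
  The product \<open>d / k\<close> of the roots is a negative real number, so one root is a negative multiple of
  the conjugate of the other, and their real parts have opposite signs. They cannot both vanish,
  because the sum of the roots has the real part \<open>- Re c / k\<close>.
\<close>

lemma friction_quadratic_right_root:
  fixes c :: complex and k d :: real
  assumes "k > 0" "Re c > 0" "d < 0"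
  shows "\<exists>z. of_real k * z\<^sup>2 + c * z + of_real d = 0 \<and> Re z > 0"
proof -
  define x where "x = (- c + csqrt (c\<^sup>2 - 4 * of_real k * of_real d)) / (2 * of_real k)"
  have k: "(of_real k :: complex) \<noteq> 0" using assms by simp
  have "(2 * of_real k * x + c)\<^sup>2 = c\<^sup>2 - 4 * of_real k * of_real d"
    using k by (simp add: x_def)
  then have "4 * of_real k * (of_real k * x\<^sup>2 + c * x + of_real d) = 0"
    by (simp add: power2_eq_square algebra_simps)
  then have x: "of_real k * x\<^sup>2 + c * x + of_real d = 0"
    using k by simp
  have x0: "x \<noteq> 0" using x assms by auto
  \<comment> \<open>The other root, from the product of the roots.\<close>
  define y where "y = of_real d / (of_real k * x)"
  have y: "of_real k * y\<^sup>2 + c * y + of_real d = 0"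
  proof -
    have "of_real k * x\<^sup>2 * (of_real k * y\<^sup>2 + c * y + of_real d)
        = of_real d * (of_real k * x\<^sup>2 + c * x + of_real d)"
      using k x0 by (simp add: y_def field_simps power2_eq_square)
    then show ?thesis using x k x0 by simp
  qed
  have "y = of_real (d / k) * inverse x"
    using k x0 by (simp add: y_def field_simps)
  then have Re_y: "Re y = d / k * (Re x / ((Re x)\<^sup>2 + (Im x)\<^sup>2))"
    by simp
  have nonzero: "Re x \<noteq> 0"
  proof
    assume "Re x = 0"
    with Re_y have "Re y = 0" by simp
    have "of_real k * x * y = of_real d"
      using k x0 by (simp add: y_def)
    moreover have "x * (of_real k * (x + y) + c)
        = (of_real k * x\<^sup>2 + c * x + of_real d) + (of_real k * x * y - of_real d)"
      by (simp add: power2_eq_square algebra_simps)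
    ultimately have "of_real k * (x + y) + c = 0"
      using x x0 by simp
    then have "Re (of_real k * (x + y) + c) = 0" by simp
    then have "k * (Re x + Re y) + Re c = 0" by simp
    then show False using \<open>Re x = 0\<close> \<open>Re y = 0\<close> assms by simp
  qed
  show ?thesis
  proof (cases "Re x > 0")
    case True
    then show ?thesis using x by blast
  next
    case False
    with nonzero have "Re x < 0" by simp
    then have "Re x / ((Re x)\<^sup>2 + (Im x)\<^sup>2) < 0"
      by (intro divide_neg_pos add_pos_nonneg) auto
    then have "Re y > 0"
      unfolding Re_y using assms by (intro mult_neg_neg) (auto simp: divide_neg_pos)
    then show ?thesis using y by blast
  qed
qed

section \<open>The linearization at a vertical rotation\<close>

lemma linearization_entry:
  assumes i: "i1 > 0" "i3 > 0" and k: "k < 6" and j: "j < 6"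
    and der: "((\<lambda>p. inner (state_basis ! k) (tippe_top_field a i1 i3 \<mu> p)) has_derivative L) (at q)"
  shows "linearization a i1 i3 \<mu> q $$ (k, j) = L (state_basis ! j)"
proof -
  let ?F = "tippe_top_field a i1 i3 \<mu>"
  have "(?F has_derivative frechet_derivative ?F (at q)) (at q)"
    using tippe_top_field_differentiable[OF i] by (simp add: frechet_derivative_works)
  then have "((\<lambda>p. inner (state_basis ! k) (?F p)) has_derivative
      (\<lambda>v. inner (state_basis ! k) (frechet_derivative ?F (at q) v))) (at q)"
    by (rule has_derivative_inner_right)
  from fun_cong[OF has_derivative_unique[OF this der], of "state_basis ! j"] show ?thesis
    using k j by (simp add: linearization_def)
qed

lemma state_basis_coordinates:
  assumes "j < 6"
  shows "fst (state_basis ! j) $ 1 = [1, 0, 0, 0, 0, 0] ! j"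
    "fst (state_basis ! j) $ 2 = [0, 1, 0, 0, 0, 0] ! j"
    "snd (state_basis ! j) $ 1 = [0, 0, 0, 1, 0, 0] ! j"
    "snd (state_basis ! j) $ 2 = [0, 0, 0, 0, 1, 0] ! j"
  using assms by (auto simp: less_Suc_eq numeral_eq_Suc state_basis_def axis_def)

lemma all_less_6: "(\<forall>j<6. P j) \<longleftrightarrow> P 0 \<and> P (1::nat) \<and> P 2 \<and> P 3 \<and> P 4 \<and> P 5"
  by (simp add: numeral_eq_Suc All_less_Suc2)

lemma force_vertical_derivative:
  fixes w s :: real
  defines "q \<equiv> (vector [0, 0, w], vector [0, 0, s]) :: state"
  assumes s: "s\<^sup>2 = 1"
  shows "((\<lambda>p. force a i1 i3 \<mu> p $ 1) has_derivative
      (\<lambda>v. - \<mu> * fst v $ 1 - (i3 - i1) * w * fst v $ 2 + \<mu> * s * w * snd v $ 1 + a * snd v $ 2)) (at q)"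
    and "((\<lambda>p. force a i1 i3 \<mu> p $ 2) has_derivative
      (\<lambda>v. (i3 - i1) * w * fst v $ 1 - \<mu> * fst v $ 2 - a * snd v $ 1 + \<mu> * s * w * snd v $ 2)) (at q)"
    and "force a i1 i3 \<mu> q $ 1 = 0" "force a i1 i3 \<mu> q $ 2 = 0"
proof -
  have s': "s * (s * x) = x" for x
    using s by (simp add: power2_eq_square flip: mult.assoc)
  show "((\<lambda>p. force a i1 i3 \<mu> p $ 1) has_derivative
      (\<lambda>v. - \<mu> * fst v $ 1 - (i3 - i1) * w * fst v $ 2 + \<mu> * s * w * snd v $ 1 + a * snd v $ 2)) (at q)"
    unfolding force_components rg_deriv_inner q_def
    by ((rule derivative_eq_intros has_derivative_coord refl)+, rule ext, simp add: algebra_simps s')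
  show "((\<lambda>p. force a i1 i3 \<mu> p $ 2) has_derivative
      (\<lambda>v. (i3 - i1) * w * fst v $ 1 - \<mu> * fst v $ 2 - a * snd v $ 1 + \<mu> * s * w * snd v $ 2)) (at q)"
    unfolding force_components rg_deriv_inner q_def
    by ((rule derivative_eq_intros has_derivative_coord refl)+, rule ext, simp add: algebra_simps s')
  show "force a i1 i3 \<mu> q $ 1 = 0" "force a i1 i3 \<mu> q $ 2 = 0"
    by (simp_all add: force_components q_def)
qed

text \<open>
  The horizontal force vanishes at a vertical rotation, so only the value of the inverse of
  \<open>J\<close> there, and not its derivative, enters the linearization.
\<close>

lemma has_derivative_mult_at_zero:
  fixes f h :: "'a :: real_normed_vector \<Rightarrow> real"
  assumes "(f has_derivative f') (at q)" "f q = 0" "h differentiable at q"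
  shows "((\<lambda>p. f p * h p) has_derivative (\<lambda>v. f' v * h q)) (at q)"
proof -
  obtain h' where "(h has_derivative h') (at q)"
    using assms(3) by (auto simp: differentiable_def)
  from has_derivative_mult[OF assms(1) this] show ?thesis using assms(2) by simp
qed

lemma field_vertical_derivative:
  fixes w s :: real
  defines "q \<equiv> (vector [0, 0, w], vector [0, 0, s]) :: state"
  assumes i: "i1 > 0" "i3 > 0" and s: "s\<^sup>2 = 1"
  shows "((\<lambda>p. fst (tippe_top_field a i1 i3 \<mu> p) $ 1) has_derivative
      (\<lambda>v. (- \<mu> * fst v $ 1 - (i3 - i1) * w * fst v $ 2 + \<mu> * s * w * snd v $ 1 + a * snd v $ 2) / i1)) (at q)"
    and "((\<lambda>p. fst (tippe_top_field a i1 i3 \<mu> p) $ 2) has_derivative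
      (\<lambda>v. ((i3 - i1) * w * fst v $ 1 - \<mu> * fst v $ 2 - a * snd v $ 1 + \<mu> * s * w * snd v $ 2) / i1)) (at q)"
    and "((\<lambda>p. snd (tippe_top_field a i1 i3 \<mu> p) $ 1) has_derivative
      (\<lambda>v. - s * fst v $ 2 + w * snd v $ 2)) (at q)"
    and "((\<lambda>p. snd (tippe_top_field a i1 i3 \<mu> p) $ 2) has_derivative
      (\<lambda>v. s * fst v $ 1 - w * snd v $ 1)) (at q)"
proof -
  let ?D = "\<lambda>p::state. i1\<^sup>2 + i1 * a\<^sup>2 * ((snd p $ 1)\<^sup>2 + (snd p $ 2)\<^sup>2)"
  let ?m = "\<lambda>p::state. a\<^sup>2 * snd p $ 1 * snd p $ 2 / ?D p"
  note f = force_vertical_derivative[OF s, of a i1 i3 \<mu> w, folded q_def]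
  have D: "?D q \<noteq> 0" using i by (simp add: q_def)
  have h: "(\<lambda>p. (i1 + a\<^sup>2 * (snd p $ j)\<^sup>2) / ?D p) differentiable at q"
    "?m differentiable at q" for j
    using D by (intro differentiable_add differentiable_mult differentiable_const
        differentiable_power differentiable_divide differentiable_coord; simp)+
  have at_q: "(i1 + a\<^sup>2 * (snd q $ 1)\<^sup>2) / ?D q = 1 / i1"
    "(i1 + a\<^sup>2 * (snd q $ 2)\<^sup>2) / ?D q = 1 / i1" "?m q = 0"
    using i by (auto simp: q_def power2_eq_square)
  have F1: "fst (tippe_top_field a i1 i3 \<mu> p) $ 1
      = force a i1 i3 \<mu> p $ 1 * ((i1 + a\<^sup>2 * (snd p $ 1)\<^sup>2) / ?D p) + force a i1 i3 \<mu> p $ 2 * ?m p" for p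
    by (simp add: field_components[OF i] add_divide_distrib distrib_left distrib_right mult_ac)
  have "((\<lambda>p. force a i1 i3 \<mu> p $ 1 * ((i1 + a\<^sup>2 * (snd p $ 1)\<^sup>2) / ?D p)
      + force a i1 i3 \<mu> p $ 2 * ?m p) has_derivative
      (\<lambda>v. (- \<mu> * fst v $ 1 - (i3 - i1) * w * fst v $ 2 + \<mu> * s * w * snd v $ 1 + a * snd v $ 2)
          * ((i1 + a\<^sup>2 * (snd q $ 1)\<^sup>2) / ?D q)
        + ((i3 - i1) * w * fst v $ 1 - \<mu> * fst v $ 2 - a * snd v $ 1 + \<mu> * s * w * snd v $ 2) * ?m q))
      (at q)"
    by (intro has_derivative_add has_derivative_mult_at_zero f h)
  then show "((\<lambda>p. fst (tippe_top_field a i1 i3 \<mu> p) $ 1) has_derivative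
      (\<lambda>v. (- \<mu> * fst v $ 1 - (i3 - i1) * w * fst v $ 2 + \<mu> * s * w * snd v $ 1 + a * snd v $ 2) / i1)) (at q)"
    unfolding F1 by (simp only: at_q mult_zero_right add_0_right times_divide_eq_right mult_1_right)
  have F2: "fst (tippe_top_field a i1 i3 \<mu> p) $ 2
      = force a i1 i3 \<mu> p $ 2 * ((i1 + a\<^sup>2 * (snd p $ 2)\<^sup>2) / ?D p) + force a i1 i3 \<mu> p $ 1 * ?m p" for p
    by (simp add: field_components[OF i] add_divide_distrib distrib_left distrib_right mult_ac)
  have "((\<lambda>p. force a i1 i3 \<mu> p $ 2 * ((i1 + a\<^sup>2 * (snd p $ 2)\<^sup>2) / ?D p)
      + force a i1 i3 \<mu> p $ 1 * ?m p) has_derivative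
      (\<lambda>v. ((i3 - i1) * w * fst v $ 1 - \<mu> * fst v $ 2 - a * snd v $ 1 + \<mu> * s * w * snd v $ 2)
          * ((i1 + a\<^sup>2 * (snd q $ 2)\<^sup>2) / ?D q)
        + (- \<mu> * fst v $ 1 - (i3 - i1) * w * fst v $ 2 + \<mu> * s * w * snd v $ 1 + a * snd v $ 2) * ?m q))
      (at q)"
    by (intro has_derivative_add has_derivative_mult_at_zero f h)
  then show "((\<lambda>p. fst (tippe_top_field a i1 i3 \<mu> p) $ 2) has_derivative
      (\<lambda>v. ((i3 - i1) * w * fst v $ 1 - \<mu> * fst v $ 2 - a * snd v $ 1 + \<mu> * s * w * snd v $ 2) / i1)) (at q)"
    unfolding F2 by (simp only: at_q mult_zero_right add_0_right times_divide_eq_right mult_1_right)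
  show "((\<lambda>p. snd (tippe_top_field a i1 i3 \<mu> p) $ 1) has_derivative
      (\<lambda>v. - s * fst v $ 2 + w * snd v $ 2)) (at q)"
    "((\<lambda>p. snd (tippe_top_field a i1 i3 \<mu> p) $ 2) has_derivative
      (\<lambda>v. s * fst v $ 1 - w * snd v $ 1)) (at q)"
    unfolding field_components[OF i]
    by (auto simp: cross3_def q_def fun_eq_iff intro!: derivative_eq_intros has_derivative_coord)
qed

lemma linearization_vertical:
  fixes w s :: real
  assumes i: "i1 > 0" "i3 > 0" and s: "s\<^sup>2 = 1"
  shows "linearization a i1 i3 \<mu> (vector [0, 0, w], vector [0, 0, s]) = mat_of_rows_list 6
    [[- \<mu> / i1, - ((i3 - i1) * w) / i1, 0, \<mu> * s * w / i1, a / i1, 0],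
     [(i3 - i1) * w / i1, - \<mu> / i1, 0, - a / i1, \<mu> * s * w / i1, 0],
     [0, 0, 0, 0, 0, 0],
     [0, - s, 0, 0, w, 0],
     [s, 0, 0, - w, 0, 0],
     [0, 0, 0, 0, 0, 0]]" (is "?A = mat_of_rows_list 6 ?R")
proof -
  note der = field_vertical_derivative[OF i s, of a \<mu> w]
  have coord: "inner (state_basis ! 0) x = fst x $ 1" "inner (state_basis ! 1) x = fst x $ 2"
    "inner (state_basis ! 3) x = snd x $ 1" "inner (state_basis ! 4) x = snd x $ 2" for x
    by (simp_all add: state_basis_def inner_prod_def inner_axis' del: One_nat_def)
  have "\<forall>j<6. ?A $$ (0, j) = ?R ! 0 ! j \<and> ?A $$ (1, j) = ?R ! 1 ! j \<and> ?A $$ (2, j) = ?R ! 2 ! j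
      \<and> ?A $$ (3, j) = ?R ! 3 ! j \<and> ?A $$ (4, j) = ?R ! 4 ! j \<and> ?A $$ (5, j) = ?R ! 5 ! j"
  proof (intro allI impI)
    fix j :: nat assume j: "j < 6"
    have "?A $$ (2, j) = 0" "?A $$ (5, j) = 0"
      using linearization_vertical_rows[OF i j] by simp_all
    moreover have "?A $$ (0, j) = (- \<mu> * fst (state_basis ! j) $ 1 - (i3 - i1) * w * fst (state_basis ! j) $ 2
        + \<mu> * s * w * snd (state_basis ! j) $ 1 + a * snd (state_basis ! j) $ 2) / i1"
      "?A $$ (1, j) = ((i3 - i1) * w * fst (state_basis ! j) $ 1 - \<mu> * fst (state_basis ! j) $ 2
        - a * snd (state_basis ! j) $ 1 + \<mu> * s * w * snd (state_basis ! j) $ 2) / i1"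
      "?A $$ (3, j) = - s * fst (state_basis ! j) $ 2 + w * snd (state_basis ! j) $ 2"
      "?A $$ (4, j) = s * fst (state_basis ! j) $ 1 - w * snd (state_basis ! j) $ 1"
      by (rule linearization_entry[OF i _ j], simp, unfold coord, rule der)+
    ultimately show "?A $$ (0, j) = ?R ! 0 ! j \<and> ?A $$ (1, j) = ?R ! 1 ! j \<and> ?A $$ (2, j) = ?R ! 2 ! j
      \<and> ?A $$ (3, j) = ?R ! 3 ! j \<and> ?A $$ (4, j) = ?R ! 4 ! j \<and> ?A $$ (5, j) = ?R ! 5 ! j"
      using j by (auto simp: state_basis_coordinates less_Suc_eq numeral_eq_Suc)
  qed
  then have "\<forall>k<6. \<forall>j<6. ?A $$ (k, j) = ?R ! k ! j"
    unfolding all_less_6[of "\<lambda>k. \<forall>j<6. ?A $$ (k, j) = ?R ! k ! j"] by blast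
  then show ?thesis
    by (intro eq_matI) (auto simp: mat_of_rows_list_def linearization_def)
qed

section \<open>The roots of the quartic factor\<close>

text \<open>
  The characteristic polynomial is \<open>\<lambda>\<^sup>2 P\<^sub>4\<close>, so away from zero the roots of \<open>P\<^sub>4\<close> are the
  eigenvalues. Working with eigenvectors avoids the expansion of a \<open>4\<times>4\<close> determinant.
\<close>

lemma P4_root_iff_eigenvalue:
  fixes z :: complex and q :: state
  assumes i: "i1 > 0" "i3 > 0"
    and q: "fst q $ 1 = 0" "fst q $ 2 = 0" "snd q $ 1 = 0" "snd q $ 2 = 0"
    and z: "z \<noteq> 0"
  shows "poly (map_poly of_real (P4 a i1 i3 \<mu> q)) z = 0
    \<longleftrightarrow> eigenvalue (map_mat of_real (linearization a i1 i3 \<mu> q)) z"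
proof -
  let ?A = "linearization a i1 i3 \<mu> q"
  have A: "?A \<in> carrier_mat 6 6" by (simp add: linearization_def)
  interpret hom: map_poly_comm_ring_hom "of_real :: real \<Rightarrow> complex" ..
  have "eigenvalue (map_mat of_real ?A) z \<longleftrightarrow> poly (char_poly (map_mat of_real ?A)) z = 0"
    using A by (intro eigenvalue_root_char_poly) simp
  also have "char_poly (map_mat of_real ?A) = map_poly (of_real :: real \<Rightarrow> complex) (char_poly ?A)"
    by (rule of_real_hom.char_poly_hom[OF A])
  also have "\<dots> = monom 1 2 * map_poly of_real (P4 a i1 i3 \<mu> q)"
    unfolding char_poly_vertical(1)[OF i q] by (simp add: hom.hom_mult)
  finally show ?thesis using z by (simp add: poly_monom)
qed

lemma mult_mat_vec_eq_smult_iff_6: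
  fixes A :: "'a :: comm_ring_1 Matrix.mat"
  assumes "A \<in> carrier_mat 6 6" "v \<in> carrier_vec 6"
  shows "A *\<^sub>v v = z \<cdot>\<^sub>v v \<longleftrightarrow>
    (\<forall>k<6. A $$ (k, 0) * Matrix.vec_index v 0 + A $$ (k, 1) * Matrix.vec_index v 1
      + A $$ (k, 2) * Matrix.vec_index v 2 + A $$ (k, 3) * Matrix.vec_index v 3
      + A $$ (k, 4) * Matrix.vec_index v 4 + A $$ (k, 5) * Matrix.vec_index v 5
      = z * Matrix.vec_index v k)"
proof -
  have "{0..<6} = {0, 1, 2, 3, 4, 5::nat}" by auto
  then show ?thesis
    using assms by (simp add: Matrix.vec_eq_iff scalar_prod_def add.assoc)
qed

lemma eigenvalue_linearization_vertical:
  fixes w s :: real and z :: complex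
  assumes i: "i1 > 0" "i3 > 0" and s: "s\<^sup>2 = 1"
  defines "q \<equiv> (vector [0, 0, w], vector [0, 0, s]) :: state"
  shows "eigenvalue (map_mat of_real (linearization a i1 i3 \<mu> q)) z \<longleftrightarrow>
    (\<exists>x0 x1 x2 y0 y1 y2. (x0, x1, x2, y0, y1, y2) \<noteq> (0, 0, 0, 0, 0, 0) \<and>
      of_real i1 * (z * x0) = - of_real \<mu> * x0 - of_real ((i3 - i1) * w) * x1
        + of_real (\<mu> * s * w) * y0 + of_real a * y1 \<and>
      of_real i1 * (z * x1) = of_real ((i3 - i1) * w) * x0 - of_real \<mu> * x1
        - of_real a * y0 + of_real (\<mu> * s * w) * y1 \<and>
      z * x2 = 0 \<and>
      z * y0 = - of_real s * x1 + of_real w * y1 \<and>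
      z * y1 = of_real s * x0 - of_real w * y0 \<and>
      z * y2 = 0)" (is "_ \<longleftrightarrow> (\<exists>x0 x1 x2 y0 y1 y2. ?E x0 x1 x2 y0 y1 y2)")
proof -
  let ?M = "map_mat complex_of_real (linearization a i1 i3 \<mu> q)"
  let ?v = "\<lambda>x0 x1 x2 y0 y1 y2. vec_of_list [x0, x1, x2, y0, y1, y2] :: complex Matrix.vec"
  have i1: "i1 \<noteq> 0" using i by simp
  have M: "?M \<in> carrier_mat 6 6" by (simp add: linearization_def)
  have entries: "?M = map_mat of_real (mat_of_rows_list 6
    [[- \<mu> / i1, - ((i3 - i1) * w) / i1, 0, \<mu> * s * w / i1, a / i1, 0],
     [(i3 - i1) * w / i1, - \<mu> / i1, 0, - a / i1, \<mu> * s * w / i1, 0],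
     [0, 0, 0, 0, 0, 0],
     [0, - s, 0, 0, w, 0],
     [s, 0, 0, - w, 0, 0],
     [0, 0, 0, 0, 0, 0]])"
    unfolding q_def linearization_vertical[OF i s] ..
  have v: "?v x0 x1 x2 y0 y1 y2 \<in> carrier_vec 6" for x0 x1 x2 y0 y1 y2
    by (rule carrier_vecI) (simp del: vec_of_list_Cons)
  have eqs: "?v x0 x1 x2 y0 y1 y2 \<noteq> 0\<^sub>v 6 \<and> ?M *\<^sub>v ?v x0 x1 x2 y0 y1 y2 = z \<cdot>\<^sub>v ?v x0 x1 x2 y0 y1 y2
      \<longleftrightarrow> ?E x0 x1 x2 y0 y1 y2" for x0 x1 x2 y0 y1 y2
  proof -
    have "?v x0 x1 x2 y0 y1 y2 \<noteq> 0\<^sub>v 6 \<longleftrightarrow> (x0, x1, x2, y0, y1, y2) \<noteq> (0, 0, 0, 0, 0, 0)"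
      by (simp add: Matrix.vec_eq_iff all_less_6 vec_of_list_index del: vec_of_list_Cons)
    moreover have "?M *\<^sub>v ?v x0 x1 x2 y0 y1 y2 = z \<cdot>\<^sub>v ?v x0 x1 x2 y0 y1 y2 \<longleftrightarrow>
      z * x0 = (- of_real \<mu> * x0 - of_real ((i3 - i1) * w) * x1
        + of_real (\<mu> * s * w) * y0 + of_real a * y1) / of_real i1 \<and>
      z * x1 = (of_real ((i3 - i1) * w) * x0 - of_real \<mu> * x1
        - of_real a * y0 + of_real (\<mu> * s * w) * y1) / of_real i1 \<and>
      z * x2 = 0 \<and>
      z * y0 = - of_real s * x1 + of_real w * y1 \<and>
      z * y1 = of_real s * x0 - of_real w * y0 \<and>
      z * y2 = 0"
      unfolding mult_mat_vec_eq_smult_iff_6[OF M v]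
      unfolding entries all_less_6 vec_of_list_index
      by (simp add: mat_of_rows_list_def add_divide_distrib diff_divide_distrib)
        (simp add: eq_commute[of "z * _"])
    moreover have "of_real i1 * x = y \<longleftrightarrow> x = y / of_real i1" for x y :: complex
      using i1 by (auto simp: field_simps)
    ultimately show ?thesis by simp
  qed
  have "v = ?v (Matrix.vec_index v 0) (Matrix.vec_index v 1) (Matrix.vec_index v 2) (Matrix.vec_index v 3)
    (Matrix.vec_index v 4) (Matrix.vec_index v 5)" if "v \<in> carrier_vec 6" for v
    using that
    by (simp add: Matrix.vec_eq_iff vec_of_list_index numeral_eq_Suc All_less_Suc2 del: vec_of_list_Cons)
  with v have "eigenvalue ?M z \<longleftrightarrow> (\<exists>x0 x1 x2 y0 y1 y2. ?v x0 x1 x2 y0 y1 y2 \<noteq> 0\<^sub>v 6 \<and>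
      ?M *\<^sub>v ?v x0 x1 x2 y0 y1 y2 = z \<cdot>\<^sub>v ?v x0 x1 x2 y0 y1 y2)"
    using M unfolding eigenvalue_def eigenvector_def by (metis carrier_matD(1))
  then show ?thesis unfolding eqs .
qed

text \<open>
  Eliminating \<open>u\<close> with the second equation. Because \<open>s\<^sup>2 = 1\<close>, the friction term \<open>\<mu> s w h\<close> cancels the
  product of \<open>\<mu>\<close> and \<open>\<i> w\<close>, which leaves a real constant term.
\<close>

lemma planar_mode_quadratic:
  fixes w s a i1 i3 \<mu> :: real and z u h :: complex
  assumes s: "s\<^sup>2 = 1"
    and u: "of_real i1 * (z * u)
      = (- of_real \<mu> + \<i> * of_real ((i3 - i1) * w)) * u + (of_real (\<mu> * s * w) - \<i> * of_real a) * h"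
    and h: "z * h = \<i> * of_real s * u - \<i> * of_real w * h"
    and nz: "u \<noteq> 0 \<or> h \<noteq> 0"
  shows "of_real i1 * z\<^sup>2 + (of_real \<mu> - \<i> * of_real (w * (i3 - 2 * i1))) * z
    + of_real ((i3 - i1) * w\<^sup>2 - s * a) = 0" (is "?q = 0")
proof -
  have s2: "(of_real s :: complex)\<^sup>2 = 1"
    using s by (metis of_real_1 of_real_power)
  have "of_real s * \<i> * (z * h) = of_real s * \<i> * (\<i> * of_real s * u - \<i> * of_real w * h)"
    by (simp only: h)
  also have "\<dots> = - ((of_real s)\<^sup>2 * u) + of_real s * of_real w * h"
    by (simp add: algebra_simps power2_eq_square)
  finally have u_h: "u = - \<i> * of_real s * (z + \<i> * of_real w) * h"
    unfolding s2 by (simp add: algebra_simps)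
  with nz have h0: "h \<noteq> 0" by auto
  have "of_real i1 * (z * u) - (- of_real \<mu> + \<i> * of_real ((i3 - i1) * w)) * u
      - (of_real (\<mu> * s * w) - \<i> * of_real a) * h
    = - \<i> * of_real s * h * ?q + \<i> * of_real a * h * (1 - (of_real s)\<^sup>2)"
    unfolding u_h by (simp add: algebra_simps power2_eq_square)
  then have "- \<i> * of_real s * h * ?q = 0" using u by (simp add: s2)
  moreover have "s \<noteq> 0" using s by auto
  ultimately show ?thesis using h0 by simp
qed

text \<open>
  The combinations \<open>x\<^sub>0 + e \<i> x\<^sub>1\<close> and \<open>y\<^sub>0 + e \<i> y\<^sub>1\<close> with \<open>e = 1\<close> and \<open>e = - 1\<close> diagonalize the
  rotations about the vertical axis and split the linearization into two planar modes. The second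
  one is the first one with \<open>w\<close>, \<open>s\<close>, \<open>a\<close> negated, which leaves \<open>s w\<close> and \<open>s a\<close> unchanged.
\<close>

lemma P4_root_iff:
  fixes w s :: real and z :: complex
  assumes i: "i1 > 0" "i3 > 0" and s: "s\<^sup>2 = 1" and z: "z \<noteq> 0"
  shows "poly (map_poly of_real (P4 a i1 i3 \<mu> (vector [0, 0, w], vector [0, 0, s]))) z = 0 \<longleftrightarrow>
    (\<exists>e\<in>{1, -1}. of_real i1 * z\<^sup>2 + (of_real \<mu> - \<i> * of_real (e * w * (i3 - 2 * i1))) * z
      + of_real ((i3 - i1) * w\<^sup>2 - s * a) = 0)" (is "?P \<longleftrightarrow> (\<exists>e\<in>{1, -1}. ?q e = 0)")
proof -
  have "?P \<longleftrightarrow> eigenvalue (map_mat of_real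
      (linearization a i1 i3 \<mu> (vector [0, 0, w], vector [0, 0, s]))) z"
    using i z by (intro P4_root_iff_eigenvalue) simp_all
  also have "\<dots> \<longleftrightarrow> (\<exists>e\<in>{1, -1}. ?q e = 0)"
  proof
    assume "eigenvalue (map_mat of_real
      (linearization a i1 i3 \<mu> (vector [0, 0, w], vector [0, 0, s]))) z"
    then obtain x0 x1 x2 y0 y1 y2 where nonzero: "(x0, x1, x2, y0, y1, y2) \<noteq> (0, 0, 0, 0, 0, 0)"
      and x: "of_real i1 * (z * x0) = - of_real \<mu> * x0 - of_real ((i3 - i1) * w) * x1
          + of_real (\<mu> * s * w) * y0 + of_real a * y1"
        "of_real i1 * (z * x1) = of_real ((i3 - i1) * w) * x0 - of_real \<mu> * x1
          - of_real a * y0 + of_real (\<mu> * s * w) * y1"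
      and y: "z * y0 = - of_real s * x1 + of_real w * y1" "z * y1 = of_real s * x0 - of_real w * y0"
      and "z * x2 = 0" "z * y2 = 0"
      unfolding eigenvalue_linearization_vertical[OF i s] by blast
    then have 0: "x2 = 0" "y2 = 0" using z by auto
    have mode: "?q e = 0"
      if e: "e = 1 \<or> e = - 1"
        and nz: "x0 + of_real e * \<i> * x1 \<noteq> 0 \<or> y0 + of_real e * \<i> * y1 \<noteq> 0" for e :: real
    proof -
      let ?u = "x0 + of_real e * \<i> * x1" and ?h = "y0 + of_real e * \<i> * y1"
      have "of_real i1 * (z * ?u) = of_real i1 * (z * x0) + of_real e * \<i> * (of_real i1 * (z * x1))"
        by (simp add: algebra_simps)
      also have "\<dots> = (- of_real \<mu> + \<i> * of_real ((i3 - i1) * (e * w))) * ?u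
        + (of_real (\<mu> * (e * s) * (e * w)) - \<i> * of_real (e * a)) * ?h"
        unfolding x y using e by (auto simp: algebra_simps)
      finally have u: "of_real i1 * (z * ?u) = \<dots>" .
      have "z * ?h = z * y0 + of_real e * \<i> * (z * y1)"
        by (simp add: algebra_simps)
      also have "\<dots> = \<i> * of_real (e * s) * ?u - \<i> * of_real (e * w) * ?h"
        unfolding x y using e by (auto simp: algebra_simps)
      finally have h: "z * ?h = \<dots>" .
      have "(e * s)\<^sup>2 = 1" using e s by auto
      from planar_mode_quadratic[OF this u h nz] show ?thesis using e by auto
    qed
    show "\<exists>e\<in>{1, -1}. ?q e = 0"
    proof (cases "x0 + \<i> * x1 = 0 \<and> y0 + \<i> * y1 = 0")
      case False
      then show ?thesis using mode[of 1] by auto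
    next
      case True
      have "x0 - \<i> * x1 \<noteq> 0 \<or> y0 - \<i> * y1 \<noteq> 0"
      proof (rule ccontr)
        assume "\<not> ?thesis"
        then have "x0 = \<i> * x1" "y0 = \<i> * y1" by simp_all
        with True have "2 * (\<i> * x1) = 0" "2 * (\<i> * y1) = 0" by simp_all
        with \<open>x0 = _\<close> \<open>y0 = _\<close> 0 nonzero show False by simp
      qed
      then show ?thesis using mode[of "- 1"] by auto
    qed
  next
    assume "\<exists>e\<in>{1, -1}. ?q e = 0"
    then obtain e :: real where e: "e = 1 \<or> e = - 1" and q: "?q e = 0" by blast
    have s2: "(of_real s :: complex)\<^sup>2 = 1"
      using s by (metis of_real_1 of_real_power)
    have s0: "s \<noteq> 0" using s by auto
    \<comment> \<open>The other mode is set to zero, \<open>x0 = e \<i> x1\<close> and \<open>y0 = e \<i> y1\<close>, and the ratio of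
      \<open>x0\<close> to \<open>y0\<close> is read off the planar equation for \<open>h\<close>.\<close>
    let ?x0 = "z + \<i> * of_real (e * w)" and ?x1 = "- \<i> * of_real e * (z + \<i> * of_real (e * w))"
      and ?y0 = "\<i> * of_real (e * s)" and ?y1 = "of_real s :: complex"
    have x0: "of_real i1 * (z * ?x0) - (- of_real \<mu> * ?x0 - of_real ((i3 - i1) * w) * ?x1
        + of_real (\<mu> * s * w) * ?y0 + of_real a * ?y1) = ?q e"
      using e s2 by (auto simp: algebra_simps power2_eq_square)
    have x1: "of_real i1 * (z * ?x1) - (of_real ((i3 - i1) * w) * ?x0 - of_real \<mu> * ?x1
        - of_real a * ?y0 + of_real (\<mu> * s * w) * ?y1) = - \<i> * of_real e * ?q e"
      using e s2 by (auto simp: algebra_simps power2_eq_square)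
    have y: "z * ?y0 = - of_real s * ?x1 + of_real w * ?y1"
      "z * ?y1 = of_real s * ?x0 - of_real w * ?y0"
      using e by (auto simp: algebra_simps)
    have "(?x0, ?x1, 0, ?y0, ?y1, 0) \<noteq> (0, 0, 0, 0, 0, 0)" using s0 by simp
    then show "eigenvalue (map_mat of_real
      (linearization a i1 i3 \<mu> (vector [0, 0, w], vector [0, 0, s]))) z"
      unfolding eigenvalue_linearization_vertical[OF i s]
      using x0[unfolded q right_minus_eq] x1[unfolded q mult_zero_right right_minus_eq] y
        mult_zero_right[of z]
      by blast
  qed
  finally show ?thesis .
qed

section \<open>Comparison of the two vertical rotations\<close>

lemma linearly_unstable_vertical_iff:
  fixes w s :: real
  assumes i: "i1 > 0" "i3 > 0" and s: "s\<^sup>2 = 1" and \<mu>: "\<mu> > 0"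
  shows "linearly_unstable a i1 i3 \<mu> (vector [0, 0, w], vector [0, 0, s])
    \<longleftrightarrow> (i3 - i1) * w\<^sup>2 - s * a < 0" (is "?U \<longleftrightarrow> ?d < 0")
proof -
  have iff: "poly (map_poly of_real (P4 a i1 i3 \<mu> (vector [0, 0, w], vector [0, 0, s]))) z = 0
    \<longleftrightarrow> (\<exists>e\<in>{1, -1}. of_real i1 * z\<^sup>2 + (of_real \<mu> - \<i> * of_real (e * w * (i3 - 2 * i1))) * z
      + of_real ?d = 0)" if "Re z > 0" for z :: complex
    using that by (intro P4_root_iff[OF i s]) auto
  show ?thesis
  proof
    assume ?U
    then obtain z where z: "Re z > 0"
      and "poly (map_poly of_real (P4 a i1 i3 \<mu> (vector [0, 0, w], vector [0, 0, s]))) z = 0"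
      unfolding linearly_unstable_def by blast
    with iff obtain e :: real where
      "of_real i1 * z\<^sup>2 + (of_real \<mu> - \<i> * of_real (e * w * (i3 - 2 * i1))) * z + of_real ?d = 0"
      by blast
    from friction_quadratic_no_right_root[OF i(1) _ _ this] \<mu> z show "?d < 0"
      by fastforce
  next
    assume "?d < 0"
    with friction_quadratic_right_root[OF i(1), of "of_real \<mu> - \<i> * of_real (1 * w * (i3 - 2 * i1))" ?d] \<mu>
    obtain z where "Re z > 0"
      "of_real i1 * z\<^sup>2 + (of_real \<mu> - \<i> * of_real (1 * w * (i3 - 2 * i1))) * z + of_real ?d = 0"
      by auto
    with iff show ?U
      unfolding linearly_unstable_def by blast
  qed
qed

theorem mainTheorem6:
  shows "\<nexists>a i1 i3 \<mu> C :: real. a > 0 \<and> i1 > 0 \<and> i3 > 0 \<and> \<mu> > 0 \<and>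
           linearly_unstable a i1 i3 \<mu> (sigma_l i3 C) \<and>
           linearly_stable a i1 i3 \<mu> (sigma_u i3 C)"
proof (safe, goal_cases)
  case (1 a i1 i3 \<mu> C)
  then have "(i3 - i1) * (C / i3)\<^sup>2 + a < 0"
    using linearly_unstable_vertical_iff[of i1 i3 "-1" \<mu> a "- C / i3"]
    by (simp add: sigma_l_def power_divide)
  \<comment> \<open>Lower and upper rotation share \<open>w\<^sup>2\<close>; only the sign of the gravity term differs.\<close>
  then have "(i3 - i1) * (C / i3)\<^sup>2 - 1 * a < 0"
    using \<open>a > 0\<close> by simp
  then have "linearly_unstable a i1 i3 \<mu> (sigma_u i3 C)"
    using 1 linearly_unstable_vertical_iff[of i1 i3 1 \<mu> a "C / i3"] by (simp add: sigma_u_def)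
  then show ?case
    using 1 by (force simp: linearly_unstable_def linearly_stable_def)
qed

end
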